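(* Let $\Delta\subset\mathbb{R}^n$ be a nondegenerate $n$-simplex with faces $F_0,\dots,F_n$ and normalized outward normals $\mathbf{k}_0,\dots,\mathbf{k}_n$, let $p_i$ be a point in the relative interior of $F_i$ for $i=0,\dots,n$, and let $A=\sum_{i=0}^n\mathbf{k}_ip_i^T$. Let $\Psi(S)=\mathrm{tr}\big(A^T(\exp S-I)\big)$ for real skew-symmetric $n\times n$ matrices $S$. Then $\Psi$ has a strict local maximum at $S=0$ if and only if: (i) $A$ is symmetric; and (ii) $A$ is almost positive definite.
   Context: $\Delta$ has vertices $v_0,\dots,v_n$, ordered so that $\mathrm{vol}(\Delta)=\frac{1}{n!}\det[v_1-v_0,\dots,v_n-v_0]>0$. $F_i$ is the face of $\Delta$ opposite $v_i$ (with vertices $v_j$, $j\ne i$). $\mathbf{k}_i$ is the outward pointing normal to $F_i$ with $|\mathbf{k}_i|=\mathrm{vol}(F_i)$ (the $(n-1)$-dimensional volume); then $\sum_{i=0}^n\mathbf{k}_i=\mathbf{0}$. Vectors are columns, so $A$ is an $n\times n$ real matrix. $\Psi$ is defined on the vector space of real skew-symmetric $n\times n$ matrices, and equals $\mathrm{tr}(A^TS)+\frac{1}{2!}\mathrm{tr}(A^TS^2)+\cdots$. It has a strict local maximum at $S=0$ if $\Psi(S)<0=\Psi(0)$ for all $S\neq0$ in some neighbourhood of $0$. A real symmetric matrix is almost positive definite if the sum of every pair of its eigenvalues is positive, where eigenvalues are listed with multiplicity and a pair means two entries with different indices in the list (an eigenvalue can be added to itself only if it is repeated). *)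

theory Defs
  imports "HOL-Analysis.Analysis" "HOL-Computational_Algebra.Polynomial"
begin

(* Matrix exponential by its power series; the type of square matrices carries the
   componentwise product, so the powers are iterated with the matrix product. *)

definition matrix_exp :: "real^'n^'n \<Rightarrow> real^'n^'n" where
  "matrix_exp S = (\<Sum>k. (1 / fact k) *\<^sub>R (((**) S ^^ k) (mat 1)))"

definition outer_product :: "real^'n \<Rightarrow> real^'n \<Rightarrow> real^'n^'n" where
  "outer_product x y = (\<chi> r c. x $ r * y $ c)"

definition Psi :: "real^'n^'n \<Rightarrow> real^'n^'n \<Rightarrow> real" where
  "Psi A S = trace (transpose A ** (matrix_exp S - mat 1))"

definition strict_local_max_on ::
  "('a::topological_space \<Rightarrow> real) \<Rightarrow> 'a set \<Rightarrow> 'a \<Rightarrow> bool" where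
  "strict_local_max_on f X a \<longleftrightarrow> a \<in> X \<and> (\<forall>\<^sub>F x in at a within X. f x < f a)"

definition char_matrix_poly :: "real^'n^'n \<Rightarrow> real poly" where
  "char_matrix_poly A = det (\<chi> i j. (if i = j then [:0, 1:] else 0) - [:A $ i $ j:])"

(* The real eigenvalues with algebraic multiplicity: all CARD('n) of them when A is symmetric. *)

definition eigenvalue_mset :: "real^'n^'n \<Rightarrow> real multiset" where
  "eigenvalue_mset A = proots (char_matrix_poly A)"

(* Inclusion of the two-element multiset says that a and b occupy different positions in the
   list of eigenvalues; in particular a = b is allowed only for a repeated eigenvalue.
   The notion is meant for symmetric A. *)

definition almost_positive_definite :: "real^'n^'n \<Rightarrow> bool" where
  "almost_positive_definite A \<longleftrightarrow>
     (\<forall>a b. {#a, b#} \<subseteq># eigenvalue_mset A \<longrightarrow> 0 < a + b)"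

(* a is an origin and b 0, ..., b (m - 1) an orthonormal basis of the affine hull of F. *)

definition orthonormal_frame ::
  "nat \<Rightarrow> 'a::euclidean_space set \<Rightarrow> 'a \<Rightarrow> (nat \<Rightarrow> 'a) \<Rightarrow> bool" where
  "orthonormal_frame m F a b \<longleftrightarrow>
     (\<forall>i<m. \<forall>j<m. b i \<bullet> b j = (if i = j then 1 else 0)) \<and>
     affine hull F = {a + (\<Sum>i<m. c i *\<^sub>R b i) | c. True}"

(* m-dimensional volume of a set F spanning an m-dimensional affine subspace: the Lebesgue
   measure of F in orthonormal coordinates, which does not depend on the frame chosen.
   For m = 0 the measure is the unit mass on the one-point space, so a point has volume 1. *)

definition flat_volume :: "nat \<Rightarrow> 'a::euclidean_space set \<Rightarrow> real" where
  "flat_volume m F =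
     (SOME r. \<exists>a b. orthonormal_frame m F a b \<and>
        r = measure (Pi\<^sub>M {..<m} (\<lambda>_. lborel))
              {c \<in> space (Pi\<^sub>M {..<m} (\<lambda>_. lborel)). a + (\<Sum>i<m. c i *\<^sub>R b i) \<in> F})"

definition outward_normal :: "'a::euclidean_space set \<Rightarrow> 'a set \<Rightarrow> 'a \<Rightarrow> bool" where
  "outward_normal D F k \<longleftrightarrow>
     (\<forall>x\<in>F. \<forall>y\<in>F. k \<bullet> (y - x) = 0) \<and> (\<forall>x\<in>F. \<forall>y\<in>D - F. k \<bullet> (y - x) < 0)"

(* The n + 1 vertices are indexed by 'n option, where n = CARD('n): v None is v_0, and the
   columns of the orientation determinant are v (Some j) - v None. *)

definition positively_ordered :: "('n option \<Rightarrow> real^'n) \<Rightarrow> bool" where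
  "positively_ordered v \<longleftrightarrow> 0 < det (\<chi> r c. (v (Some c) - v None) $ r)"

end

theory Submission
  imports Defs
begin

text \<open>
The trace pairing is the Frobenius inner product, so \<open>Psi A S = A \<bullet> S + A \<bullet> S\<^sup>2 / 2 + O(norm S ^ 3)\<close>.
On skew-symmetric \<open>S\<close> the linear term vanishes identically exactly when \<open>A\<close> is symmetric, and a
local maximum forces it to vanish (\<open>symmetric_if_strict_local_max\<close>).

Let \<open>A\<close> be symmetric with eigenvalues \<open>d\<^sub>i\<close>, and let \<open>T\<close> be \<open>S\<close> in an orthonormal eigenbasis. Then
\<open>A \<bullet> S\<^sup>2\<close> is minus the sum of \<open>(d\<^sub>i + d\<^sub>j) T\<^sub>i\<^sub>j\<^sup>2\<close> over the unordered pairs \<open>i \<noteq> j\<close>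
(\<open>quadratic_form_diagonalization\<close>), which is negative definite exactly when all sums of two
eigenvalues at different indices are positive. If they are, the quadratic term dominates the cubic
remainder (\<open>Psi_second_order\<close>) and the maximum is strict.
If \<open>d\<^sub>i + d\<^sub>j \<le> 0\<close> for some \<open>i \<noteq> j\<close>, let \<open>K\<close> generate the rotations in the plane of the two
eigenvectors. The exponential series sums to \<open>Psi A (t K) = (d\<^sub>i + d\<^sub>j) (cos t - 1) \<ge> 0\<close>
(\<open>Psi_rotation_of_eigenvectors\<close>), so the maximum is not strict. This settles the borderline case
\<open>d\<^sub>i + d\<^sub>j = 0\<close> as well, where the quadratic term gives no information.
\<close>

section \<open>The spectral theorem\<close>

text \<open>A maximizer \<open>x\<close> of the Rayleigh quotient over the unit sphere of \<open>V\<close> is an eigenvector. With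
\<open>m\<close> the maximum and \<open>z = f x - m x\<close>, which is orthogonal to \<open>x\<close>, the quotient at \<open>x + t z\<close> exceeds
\<open>m\<close> to first order in \<open>t\<close> unless \<open>z = 0\<close>.\<close>

lemma selfadjoint_eigenvector_on_subspace:
  fixes f :: "'a::euclidean_space \<Rightarrow> 'a"
  assumes lin: "linear f" and sa: "\<And>x y. f x \<bullet> y = x \<bullet> f y"
    and V: "subspace V" "f ` V \<subseteq> V" "V \<noteq> {0}"
  obtains x c where "x \<in> V" "norm x = 1" "f x = c *\<^sub>R x"
proof -
  interpret linear f by (fact lin)
  define K where "K = V \<inter> sphere 0 1"
  obtain w where w: "w \<in> V" "w \<noteq> 0"
    using V subspace_0 by blast
  have "w /\<^sub>R norm w \<in> K"
    using w V by (auto simp: K_def subspace_scale)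
  moreover have "compact K"
    unfolding K_def using V by (intro closed_Int_compact closed_subspace compact_sphere)
  moreover have "continuous_on K (\<lambda>x. x \<bullet> f x)"
    by (intro continuous_intros linear_continuous_on linear_conv_bounded_linear[THEN iffD1] lin)
  ultimately obtain x where x: "x \<in> K" and max: "\<And>y. y \<in> K \<Longrightarrow> y \<bullet> f y \<le> x \<bullet> f x"
    by (metis continuous_attains_sup empty_iff)
  define m where "m = x \<bullet> f x"
  have xV: "x \<in> V" and nx: "x \<bullet> x = 1"
    using x by (auto simp: K_def dist_norm norm_eq_1)
  have bound: "y \<bullet> f y \<le> m * (y \<bullet> y)" if "y \<in> V" for y
  proof (cases "y = 0")
    case False
    then have "y /\<^sub>R norm y \<in> K"
      using that V by (auto simp: K_def subspace_scale)
    from max[OF this] have "(y \<bullet> f y) / (norm y)\<^sup>2 \<le> m"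
      by (simp add: m_def scale power2_eq_square field_simps)
    then show ?thesis
      using False by (simp add: field_simps power2_norm_eq_inner)
  qed (simp add: zero)
  have fxV: "f x \<in> V" using V xV by auto
  define z where "z = f x - m *\<^sub>R x"
  have zV: "z \<in> V"
    unfolding z_def using V xV fxV by (simp add: subspace_diff subspace_scale)
  have xz: "x \<bullet> z = 0"
    by (simp add: z_def inner_diff_right m_def nx)
  have zfx: "z \<bullet> f x = z \<bullet> z"
    using xz by (simp add: z_def inner_diff_right inner_diff_left inner_commute)
  define q where "q = m * (z \<bullet> z) - z \<bullet> f z"
  have ineq: "2 * t * (z \<bullet> z) \<le> t\<^sup>2 * q" for t
  proof -
    have "x + t *\<^sub>R z \<in> V"
      using V xV zV by (simp add: subspace_add subspace_scale)
    from bound[OF this] have "m + 2 * t * (z \<bullet> f x) + t\<^sup>2 * (z \<bullet> f z) \<le> m * (1 + t\<^sup>2 * (z \<bullet> z))"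
      using sa[of x z] xz nx
      by (simp add: add scale inner_add_left inner_add_right m_def inner_commute power2_eq_square algebra_simps)
    then show ?thesis by (simp add: q_def zfx algebra_simps)
  qed
  have "z \<bullet> z \<le> 0"
  proof (rule ccontr)
    assume "\<not> z \<bullet> z \<le> 0"
    then have pos: "z \<bullet> z > 0" by linarith
    have q: "q > 0" using ineq[of 1] pos by (simp del: inner_gt_zero_iff)
    have "2 * ((z \<bullet> z) / q) * (z \<bullet> z) \<le> ((z \<bullet> z) / q)\<^sup>2 * q"
      by (rule ineq)
    also have "\<dots> = ((z \<bullet> z) / q) * (z \<bullet> z)" using q by (simp add: power2_eq_square)
    finally show False using mult_pos_pos[OF divide_pos_pos[OF pos q] pos] by linarith
  qed
  then have "z = 0" using inner_ge_zero[of z] by (metis inner_eq_zero_iff order_antisym)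
  then have "f x = m *\<^sub>R x" by (simp add: z_def)
  with xV nx show ?thesis using that by (simp add: norm_eq_1)
qed

text \<open>Induction on the dimension: split off one eigenvector \<open>x\<close> in \<open>V\<close>. Self-adjointness makes the
orthogonal complement of \<open>x\<close> in \<open>V\<close> invariant again.\<close>

lemma selfadjoint_orthonormal_eigenbasis:
  fixes f :: "'a::euclidean_space \<Rightarrow> 'a"
  assumes lin: "linear f" and sa: "\<And>x y. f x \<bullet> y = x \<bullet> f y"
    and "subspace V" "f ` V \<subseteq> V"
  shows "\<exists>B. pairwise orthogonal B \<and> (\<forall>b\<in>B. norm b = 1 \<and> (\<exists>c. f b = c *\<^sub>R b)) \<and> span B = V"
  using assms(3,4)
proof (induction "dim V" arbitrary: V rule: less_induct)
  case less
  show ?case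
  proof (cases "V = {0}")
    case True
    then show ?thesis by (intro exI[of _ "{}"]) auto
  next
    case False
    obtain x c where x: "x \<in> V" "norm x = 1" "f x = c *\<^sub>R x"
      using selfadjoint_eigenvector_on_subspace[OF lin sa less.prems False] by blast
    define W where "W = V \<inter> {y. x \<bullet> y = 0}"
    have W: "subspace W"
      unfolding W_def using less.prems(1) subspace_hyperplane by (rule subspace_inter)
    have nx: "x \<bullet> x = 1" using x by (simp add: norm_eq_1)
    have fW: "f ` W \<subseteq> W"
    proof clarify
      fix y assume "y \<in> W"
      then show "f y \<in> W"
        using less.prems(2) sa[of x y] x by (auto simp: W_def)
    qed
    have "dim W < dim V"
    proof (rule dim_psubset)
      have "x \<notin> W" by (simp add: W_def nx)
      then show "span W \<subset> span V"
        using x(1) unfolding span_eq_iff[THEN iffD2, OF W] span_eq_iff[THEN iffD2, OF less.prems(1)]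
        by (auto simp only: W_def psubset_eq)
    qed
    from less.hyps[OF this W fW] obtain B where B: "pairwise orthogonal B"
      "\<And>b. b \<in> B \<Longrightarrow> norm b = 1 \<and> (\<exists>c. f b = c *\<^sub>R b)" "span B = W"
      by blast
    have BW: "B \<subseteq> W" using B(3) span_superset by blast
    have "span (insert x B) = V"
    proof
      show "span (insert x B) \<subseteq> V"
        using BW x less.prems(1) by (intro span_minimal) (auto simp: W_def)
      show "V \<subseteq> span (insert x B)"
      proof
        fix y assume "y \<in> V"
        then have "y - (x \<bullet> y) *\<^sub>R x \<in> W"
          using x less.prems(1) nx by (auto simp: W_def subspace_diff subspace_scale inner_diff_right)
        then show "y \<in> span (insert x B)"
          using B(3) by (auto simp: span_breakdown_eq)
      qed
    qed
    moreover have "pairwise orthogonal (insert x B)"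
      using B(1) BW by (auto simp: pairwise_insert orthogonal_def W_def inner_commute)
    ultimately show ?thesis using B(2) x
      by (intro exI[of _ "insert x B"]) auto
  qed
qed

definition diagonal_matrix :: "('n \<Rightarrow> 'a::zero) \<Rightarrow> 'a^'n^'n" where
  "diagonal_matrix d = (\<chi> i j. if i = j then d i else 0)"

lemma symmetric_matrix_diagonalization:
  fixes A :: "real^'n^'n"
  assumes "transpose A = A"
  obtains P d where "orthogonal_matrix P" "A = P ** diagonal_matrix d ** transpose P"
proof -
  have sa: "(A *v x) \<bullet> y = x \<bullet> (A *v y)" for x y
    using assms by (metis dot_lmul_matrix transpose_matrix_vector)
  obtain B where B: "pairwise orthogonal B"
    "\<And>b. b \<in> B \<Longrightarrow> norm b = 1 \<and> (\<exists>c. A *v b = c *\<^sub>R b)" "span B = (UNIV :: (real^'n) set)"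
    using selfadjoint_orthonormal_eigenbasis[of "(*v) A" UNIV, OF matrix_vector_mul_linear sa]
    by auto
  have "0 \<notin> B" using B(2) by force
  then have ind: "independent B" by (intro pairwise_orthogonal_independent B)
  then have "card B = CARD('n)" "finite B"
    using B(3) by (auto simp: dim_eq_card dest: independent_imp_finite)
       (metis dim_UNIV dim_eq_card dim_span DIM_cart DIM_real mult.right_neutral)
  then obtain u where u: "bij_betw u (UNIV::'n set) B"
    by (metis finite_same_card_bij finite)
  define P :: "real^'n^'n" where "P = (\<chi> i j. u j $ i)"
  have col: "column j P = u j" for j
    by (simp add: column_def P_def vec_eq_iff)
  have uB: "u j \<in> B" for j using u by (auto simp: bij_betw_def)
  have uu: "u i \<noteq> u j" if "i \<noteq> j" for i j
    using u that by (auto simp: bij_betw_def inj_on_def)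
  have orth: "orthogonal_matrix P"
    unfolding orthogonal_matrix_orthonormal_columns col
    using B(1,2) uB uu by (auto simp: pairwise_def)
  obtain d where d: "\<And>j. A *v u j = d j *\<^sub>R u j"
    using B(2)[OF uB] by metis
  have "(A ** P) $ i $ j = (P ** diagonal_matrix d) $ i $ j" for i j
  proof -
    have "(A ** P) $ i $ j = (A *v u j) $ i"
      by (simp add: matrix_matrix_mult_def matrix_vector_mult_def P_def)
    also have "\<dots> = (P ** diagonal_matrix d) $ i $ j"
      by (simp add: d matrix_matrix_mult_def diagonal_matrix_def P_def if_distrib cong: if_cong)
    finally show ?thesis .
  qed
  then have "A ** P = P ** diagonal_matrix d" by (simp add: vec_eq_iff)
  then have "P ** diagonal_matrix d ** transpose P = A ** (P ** transpose P)"
    by (simp add: matrix_mul_assoc)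
  also have "\<dots> = A" using orth by (simp add: orthogonal_matrix_def)
  finally show ?thesis using that orth by metis
qed

text \<open>The characteristic polynomial is invariant under conjugation. The determinant is taken in the ring
of real polynomials, so the conjugation is carried out there: \<open>lift\<close> embeds real matrices as
matrices of constant polynomials and is multiplicative.\<close>

lemma eigenvalue_mset_diagonalization:
  fixes P :: "real^'n^'n"
  assumes "orthogonal_matrix P"
  shows "eigenvalue_mset (P ** diagonal_matrix d ** transpose P) = image_mset d (mset_set UNIV)"
proof -
  let ?A = "P ** diagonal_matrix d ** transpose P"
  define lift :: "real^'n^'n \<Rightarrow> real poly^'n^'n" where "lift M = (\<chi> i j. [:M $ i $ j:])" for M
  have lift_mult: "lift (M ** N) = lift M ** lift N" for M N
  proof -
    have const_add: "[:a:] + [:b:] = [:a + b:]" for a b :: real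
      by simp
    have "[:\<Sum>k\<in>K. f k:] = (\<Sum>k\<in>K. [:f k:])" for f :: "'n \<Rightarrow> real" and K
      by (induction K rule: infinite_finite_induct) (simp_all del: add_pCons flip: const_add)
    then show ?thesis by (simp add: lift_def matrix_matrix_mult_def vec_eq_iff mult.commute)
  qed
  define X :: "real poly^'n^'n" where "X = diagonal_matrix (\<lambda>_. [:0, 1:])"
  have "lift (mat 1) = mat 1" by (simp add: lift_def mat_def vec_eq_iff)
  then have inv: "lift P ** lift (transpose P) = mat 1"
    using assms by (simp add: orthogonal_matrix_def flip: lift_mult)
  have Xscal: "M ** X ** N = X ** (M ** N)" for M N :: "real poly^'n^'n"
  proof -
    have "M ** X = X ** M"
      by (simp add: vec_eq_iff matrix_matrix_mult_def X_def diagonal_matrix_def if_distrib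
          if_distribR mult.commute cong: if_cong)
    then show ?thesis by (simp add: matrix_mul_assoc)
  qed
  have "(\<chi> i j. (if i = j then [:0, 1:] else 0) - [:?A $ i $ j:]) = X - lift ?A"
    by (simp add: X_def diagonal_matrix_def lift_def vec_eq_iff)
  also have "\<dots> = lift P ** (X - lift (diagonal_matrix d)) ** lift (transpose P)"
  proof -
    have "lift P ** (X - lift (diagonal_matrix d)) ** lift (transpose P)
       = lift P ** X ** lift (transpose P) - lift P ** lift (diagonal_matrix d) ** lift (transpose P)"
      by (simp add: vec_eq_iff matrix_matrix_mult_def algebra_simps sum_subtractf)
    then show ?thesis by (simp add: Xscal inv lift_mult)
  qed
  finally have "char_matrix_poly ?A
      = det (lift P) * det (X - lift (diagonal_matrix d)) * det (lift (transpose P))"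
    by (simp add: char_matrix_poly_def det_mul)
  also have "\<dots> = det (X - lift (diagonal_matrix d)) * det (lift P ** lift (transpose P))"
    by (simp add: det_mul)
  also have "\<dots> = det (X - lift (diagonal_matrix d))" by (simp add: inv)
  also have "\<dots> = (\<Prod>i\<in>UNIV. (X - lift (diagonal_matrix d)) $ i $ i)"
    by (rule det_diagonal) (simp add: X_def lift_def diagonal_matrix_def)
  also have "\<dots> = (\<Prod>i\<in>UNIV. [:- d i, 1:])"
    by (simp add: X_def lift_def diagonal_matrix_def)
  finally have "eigenvalue_mset ?A = (\<Sum>i\<in>UNIV. {#d i#})"
    by (simp add: eigenvalue_mset_def proots_prod)
  also have "\<dots> = image_mset d (mset_set UNIV)"
  proof -
    have "(\<Sum>i\<in>I. {#d i#}) = image_mset d (mset_set I)" for I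
      by (induction I rule: infinite_finite_induct) auto
    then show ?thesis .
  qed
  finally show ?thesis .
qed

text \<open>Two-element submultisets of the multiset of the \<open>d i\<close> are the pairs of values at two different
indices, so equal eigenvalues at different indices count as a pair.\<close>

lemma almost_positive_definite_diagonalization:
  fixes P :: "real^'n^'n"
  assumes "orthogonal_matrix P"
  shows "almost_positive_definite (P ** diagonal_matrix d ** transpose P)
    \<longleftrightarrow> (\<forall>i j. i \<noteq> j \<longrightarrow> 0 < d i + d j)"
proof -
  have "{#a, b#} \<subseteq># image_mset d (mset_set UNIV) \<longleftrightarrow> (\<exists>i j. i \<noteq> j \<and> a = d i \<and> b = d j)" for a b
  proof
    assume "{#a, b#} \<subseteq># image_mset d (mset_set UNIV)"
    then obtain R where "image_mset d (mset_set UNIV) = add_mset a (add_mset b R)"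
      by (auto simp: mset_subset_eq_exists_conv)
    from msed_map_invR[OF this] obtain i N where
      N: "mset_set UNIV = add_mset i N" "d i = a" "image_mset d N = add_mset b R"
      by blast
    from msed_map_invR[OF N(3)] obtain j N' where ij: "N = add_mset j N'" "d j = b"
      by blast
    have "count (mset_set (UNIV::'n set)) i = 1" by simp
    then have "i \<noteq> j" unfolding N(1) ij(1) by auto
    with N(2) ij(2) show "\<exists>i j. i \<noteq> j \<and> a = d i \<and> b = d j" by blast
  next
    assume "\<exists>i j. i \<noteq> j \<and> a = d i \<and> b = d j"
    then obtain i j where ij: "i \<noteq> j" "a = d i" "b = d j" by blast
    then have "{#i, j#} = mset_set {i, j}" by simp
    also have "\<dots> \<subseteq># mset_set UNIV" by (intro subset_imp_msubset_mset_set) auto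
    finally have "image_mset d {#i, j#} \<subseteq># image_mset d (mset_set UNIV)"
      by (rule image_mset_subseteq_mono)
    then show "{#a, b#} \<subseteq># image_mset d (mset_set UNIV)" using ij by simp
  qed
  then show ?thesis
    unfolding almost_positive_definite_def eigenvalue_mset_diagonalization[OF assms] by metis
qed

section \<open>The power series of Psi\<close>

abbreviation matrix_power :: "real^'n^'n \<Rightarrow> nat \<Rightarrow> real^'n^'n" where
  "matrix_power S k \<equiv> ((**) S ^^ k) (mat 1)"

text \<open>The inner product of matrices as vectors of vectors is the Frobenius inner product. Hence
\<open>Psi A S = A \<bullet> (matrix_exp S - mat 1)\<close>, and the Cauchy--Schwarz inequality applies.\<close>

lemma inner_matrix_eq_trace:
  fixes A B :: "real^'n^'n"
  shows "A \<bullet> B = trace (transpose A ** B)"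
proof -
  have "A \<bullet> B = (\<Sum>i\<in>UNIV. \<Sum>j\<in>UNIV. A $ i $ j * B $ i $ j)"
    by (simp add: inner_vec_def)
  also have "\<dots> = (\<Sum>j\<in>UNIV. \<Sum>i\<in>UNIV. A $ i $ j * B $ i $ j)"
    by (rule sum.swap)
  also have "\<dots> = trace (transpose A ** B)"
    by (simp add: trace_def matrix_matrix_mult_def transpose_def)
  finally show ?thesis .
qed

text \<open>Each entry of the product is the inner product of a row of \<open>A\<close> and a column of \<open>B\<close>; apply the
Cauchy--Schwarz inequality entrywise and add up.\<close>

lemma norm_matrix_mult_le:
  fixes A B :: "real^'n^'n"
  shows "norm (A ** B) \<le> norm A * norm B"
proof (rule power2_le_imp_le)
  have norm_sq: "(norm M)\<^sup>2 = (\<Sum>i\<in>UNIV. (norm (M $ i))\<^sup>2)" for M :: "real^'n^'n"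
    by (simp add: norm_vec_def L2_set_def sum_nonneg)
  have norm_cols: "(norm B)\<^sup>2 = (\<Sum>j\<in>UNIV. (norm (column j B))\<^sup>2)"
    unfolding norm_sq by (simp add: norm_vec_def L2_set_def sum_nonneg column_def) (rule sum.swap)
  have "(norm (A ** B))\<^sup>2 = (\<Sum>i\<in>UNIV. \<Sum>j\<in>UNIV. (A $ i \<bullet> column j B)\<^sup>2)"
    by (simp add: norm_vec_def L2_set_def sum_nonneg matrix_matrix_mult_def inner_vec_def column_def)
  also have "\<dots> \<le> (\<Sum>i\<in>UNIV. \<Sum>j\<in>UNIV. (norm (A $ i))\<^sup>2 * (norm (column j B))\<^sup>2)"
    by (intro sum_mono) (metis Cauchy_Schwarz_ineq power2_norm_eq_inner)
  also have "\<dots> = (norm A * norm B)\<^sup>2"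
    by (simp add: power_mult_distrib norm_sq[of A] norm_cols sum_product)
  finally show "(norm (A ** B))\<^sup>2 \<le> (norm A * norm B)\<^sup>2" .
qed simp

text \<open>The exponent starts at 1, since \<open>norm (mat 1)\<close> is the square root of the dimension, not 1.\<close>

lemma norm_matrix_power_le:
  fixes S :: "real^'n^'n"
  shows "norm (matrix_power S (Suc k)) \<le> norm S ^ Suc k"
proof (induction k)
  case (Suc k)
  have "norm (matrix_power S (Suc (Suc k))) \<le> norm S * norm (matrix_power S (Suc k))"
    using norm_matrix_mult_le[of S "matrix_power S (Suc k)"] by simp
  also have "\<dots> \<le> norm S * norm S ^ Suc k"
    using Suc by (intro mult_left_mono) auto
  finally show ?case by simp
qed simp

lemma matrix_exp_sums:
  fixes S :: "real^'n^'n"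
  shows "(\<lambda>k. (1 / fact k) *\<^sub>R matrix_power S k) sums matrix_exp S"
proof -
  have "summable (\<lambda>k. (1 / fact (Suc k)) *\<^sub>R matrix_power S (Suc k))"
  proof (rule summable_comparison_test')
    show "summable (\<lambda>k. norm S ^ Suc k /\<^sub>R fact (Suc k))"
      using summable_exp_generic[of "norm S"] by (subst summable_Suc_iff)
    show "norm ((1 / fact (Suc k)) *\<^sub>R matrix_power S (Suc k)) \<le> norm S ^ Suc k /\<^sub>R fact (Suc k)" for k
      using norm_matrix_power_le[where S = S and k = k]
      by (simp add: divide_inverse mult_left_mono del: fact_Suc power_Suc funpow.simps)
  qed
  then have "summable (\<lambda>k. (1 / fact k) *\<^sub>R matrix_power S k)"
    by (subst (asm) summable_Suc_iff)
  then show ?thesis unfolding matrix_exp_def by (rule summable_sums)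
qed

lemma Psi_sums:
  fixes A S :: "real^'n^'n"
  shows "(\<lambda>k. A \<bullet> matrix_power S (Suc k) / fact (Suc k)) sums Psi A S"
proof -
  have "(\<lambda>k. (1 / fact (Suc k)) *\<^sub>R matrix_power S (Suc k)) sums (matrix_exp S - mat 1)"
    using matrix_exp_sums[of S] by (subst sums_Suc_iff) simp
  from bounded_linear.sums[OF bounded_linear_inner_right this, of A]
  show ?thesis
    by (simp add: Psi_def flip: inner_matrix_eq_trace del: fact_Suc funpow.simps)
qed

lemma Psi_zero:
  fixes A :: "real^'n^'n"
  shows "Psi A 0 = 0"
proof -
  have "matrix_power (0::real^'n^'n) (Suc k) = 0" for k
    by (simp add: matrix_matrix_mult_def vec_eq_iff)
  then have "(\<lambda>k. 0 :: real) sums Psi A 0"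
    using Psi_sums[of A 0] by (simp only: inner_zero_right div_0)
  then show ?thesis by (rule sums_unique2) (rule sums_zero)
qed

text \<open>From the cubic term on, the series is dominated by \<open>norm A * norm S ^ 3\<close> times the exponential
series at 1, because \<open>norm S \<le> 1\<close> and \<open>fact k \<le> fact (k + 3)\<close>.\<close>

lemma Psi_second_order:
  fixes A S :: "real^'n^'n"
  assumes "norm S \<le> 1"
  shows "\<bar>Psi A S - (A \<bullet> S + A \<bullet> (S ** S) / 2)\<bar> \<le> norm A * exp 1 * norm S ^ 3"
proof -
  define r where "r k = A \<bullet> matrix_power S (Suc (k + 2)) / fact (Suc (k + 2))" for k
  have "r sums (Psi A S - (A \<bullet> S + A \<bullet> (S ** S) / 2))"
    unfolding r_def using sums_split_initial_segment[OF Psi_sums[of A S], of 2]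
    by (simp add: eval_nat_numeral)
  moreover have "(\<lambda>k. norm A * norm S ^ 3 * (1 ^ k /\<^sub>R fact k)) sums (norm A * norm S ^ 3 * exp 1)"
    by (intro sums_mult exp_converges)
  moreover have "norm (r k) \<le> norm A * norm S ^ 3 * (1 ^ k /\<^sub>R fact k)" for k
  proof -
    have "\<bar>A \<bullet> matrix_power S (Suc (k + 2))\<bar> \<le> norm A * norm (matrix_power S (Suc (k + 2)))"
      by (rule Cauchy_Schwarz_ineq2)
    also have "\<dots> \<le> norm A * norm S ^ (Suc (k + 2))"
      by (intro mult_left_mono norm_matrix_power_le) simp
    also have "\<dots> \<le> norm A * norm S ^ 3"
      using assms by (intro mult_left_mono power_decreasing) auto
    finally have "\<bar>A \<bullet> matrix_power S (Suc (k + 2))\<bar> \<le> norm A * norm S ^ 3" .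
    moreover have "(fact k :: real) \<le> fact (Suc (k + 2))" by (intro fact_mono) simp
    ultimately have "\<bar>A \<bullet> matrix_power S (Suc (k + 2))\<bar> / fact (Suc (k + 2)) \<le> norm A * norm S ^ 3 / fact k"
      by (intro frac_le) auto
    then show ?thesis by (simp add: r_def divide_inverse abs_mult del: fact_Suc funpow.simps)
  qed
  ultimately have "norm (Psi A S - (A \<bullet> S + A \<bullet> (S ** S) / 2)) \<le> norm A * norm S ^ 3 * exp 1"
    using norm_suminf_le[of r "\<lambda>k. norm A * norm S ^ 3 * (1 ^ k /\<^sub>R fact k)"]
    by (simp only: sums_iff)
  then show ?thesis by (simp add: mult_ac)
qed

lemma matrix_power_scaleR:
  fixes S :: "real^'n^'n"
  shows "matrix_power (t *\<^sub>R S) k = t ^ k *\<^sub>R matrix_power S k"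
proof (induction k)
  case (Suc k)
  have "(t *\<^sub>R S) ** (c *\<^sub>R M) = (t * c) *\<^sub>R (S ** M)" for c and M :: "real^'n^'n"
    by (simp add: matrix_matrix_mult_def vec_eq_iff sum_distrib_left mult_ac)
  then show ?case by (simp add: Suc)
qed simp

text \<open>When \<open>K\<^sup>3 = - K\<close>, the powers of \<open>K\<close> repeat up to sign with period two, and
\<open>exp (t K) = 1 + sin t K + (1 - cos t) K\<^sup>2\<close>; for the skew-symmetric \<open>K\<close> used below this is the
rotation by the angle \<open>t\<close> in a plane. Pairing with \<open>A\<close> kills the odd powers and leaves the cosine
series without its constant term.\<close>

lemma Psi_along_line_if_cube_eq_uminus:
  fixes A K :: "real^'n^'n"
  assumes "K ** (K ** K) = - K" "A \<bullet> K = 0"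
  shows "Psi A (t *\<^sub>R K) = A \<bullet> (K ** K) * (1 - cos t)"
proof -
  let ?q = "A \<bullet> (K ** K)"
  have rec: "matrix_power K (Suc (Suc (Suc k))) = - matrix_power K (Suc k)" for k
  proof -
    have "matrix_power K (Suc (Suc (Suc k))) = (K ** (K ** K)) ** matrix_power K k"
      by (simp add: matrix_mul_assoc)
    also have "\<dots> = - matrix_power K (Suc k)"
      unfolding assms(1) by (simp add: matrix_matrix_mult_def vec_eq_iff sum_negf)
    finally show ?thesis .
  qed
  have inner_power: "A \<bullet> matrix_power K (Suc k) = - ?q * (fact (Suc k) * cos_coeff (Suc k))" for k
  proof (induction k rule: induct_nat_012)
    case 0
    show ?case using assms(2) by (simp add: cos_coeff_def)
  next
    case 1
    show ?case by (simp add: cos_coeff_def)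
  next
    case (ge2 k)
    have "fact (Suc (Suc (Suc k))) * cos_coeff (Suc (Suc (Suc k))) = - (fact (Suc k) * cos_coeff (Suc k) :: real)"
      by (simp add: cos_coeff_def del: fact_Suc)
    then show ?case unfolding rec using ge2(1) by (simp only: inner_minus_right mult_minus_right)
  qed
  have "(\<lambda>k. cos_coeff (Suc k) * t ^ Suc k) sums (cos t - 1)"
    using cos_converges[of t] by (subst sums_Suc_iff) simp
  then have "(\<lambda>k. - ?q * (cos_coeff (Suc k) * t ^ Suc k)) sums (- ?q * (cos t - 1))"
    by (rule sums_mult)
  moreover have "A \<bullet> matrix_power (t *\<^sub>R K) (Suc k) / fact (Suc k)
      = - ?q * (cos_coeff (Suc k) * t ^ Suc k)" for k
  proof -
    have "(fact (Suc k) :: real) \<noteq> 0" by (rule fact_nonzero)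
    then show ?thesis
      unfolding matrix_power_scaleR inner_scaleR_right inner_power by simp
  qed
  ultimately have "(\<lambda>k. A \<bullet> matrix_power (t *\<^sub>R K) (Suc k) / fact (Suc k)) sums (- ?q * (cos t - 1))"
    by (simp only:)
  then have "Psi A (t *\<^sub>R K) = - ?q * (cos t - 1)"
    by (rule sums_unique2[OF Psi_sums])
  then show ?thesis by (simp add: algebra_simps)
qed

section \<open>The quadratic form on skew-symmetric matrices\<close>

lemma inner_transpose:
  fixes A B :: "real^'n^'m"
  shows "transpose A \<bullet> transpose B = A \<bullet> B"
  by (simp add: inner_vec_def transpose_def) (rule sum.swap)

lemma inner_symmetric_skew:
  fixes A S :: "real^'n^'n"
  assumes "transpose A = A" "transpose S = - S"
  shows "A \<bullet> S = 0"
  using inner_transpose[of A S] assms by simp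

lemma skew_matrix_component:
  fixes S :: "real^'n^'n"
  assumes "transpose S = - S"
  shows "S $ j $ i = - (S $ i $ j)"
proof -
  have "transpose S $ i $ j = (- S) $ i $ j" by (simp only: assms)
  then show ?thesis by (simp add: transpose_def)
qed

text \<open>In the eigenbasis, with \<open>T = P\<^sup>T S P\<close>, the form is \<open>tr (D T\<^sup>2) = \<Sum> d\<^sub>i T\<^sub>i\<^sub>j T\<^sub>j\<^sub>i = - \<Sum> d\<^sub>i T\<^sub>i\<^sub>j\<^sup>2\<close>;
averaging with the same sum with \<open>i\<close> and \<open>j\<close> exchanged makes the pair sums of eigenvalues appear.
The factor \<open>P ** transpose P\<close>, the identity for orthogonal \<open>P\<close>, is what turns the trace into an
expression in \<open>T\<close>.\<close>

lemma quadratic_form_diagonalization: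
  fixes P S :: "real^'n^'n"
  assumes S: "transpose S = - S"
  defines "T \<equiv> transpose P ** S ** P"
  shows "(P ** diagonal_matrix d ** transpose P) \<bullet> (S ** (P ** transpose P) ** S)
    = - (\<Sum>i\<in>UNIV. \<Sum>j\<in>UNIV. (d i + d j) * (T $ i $ j)\<^sup>2) / 2"
proof -
  let ?D = "diagonal_matrix d :: real^'n^'n"
  have tD: "transpose ?D = ?D"
    by (simp add: transpose_def diagonal_matrix_def vec_eq_iff)
  have neg: "X ** (- Y) = - (X ** Y)" "(- X) ** Y = - (X ** Y)" for X Y :: "real^'n^'n"
    by (simp_all add: matrix_matrix_mult_def vec_eq_iff sum_negf)
  have "transpose T = - T"
    by (simp add: T_def matrix_transpose_mul S neg matrix_mul_assoc)
  note skew = skew_matrix_component[OF this]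
  have skew_mult: "T $ i $ j * T $ j $ i = - (T $ i $ j)\<^sup>2" for i j
    by (simp only: skew[of i j] power2_eq_square mult_minus_right)
  have skew_sq: "(T $ j $ i)\<^sup>2 = (T $ i $ j)\<^sup>2" for i j
    by (simp only: skew[of i j] power2_minus)
  have "(P ** ?D ** transpose P) \<bullet> (S ** (P ** transpose P) ** S)
      = trace (P ** (?D ** transpose P ** S ** P ** transpose P ** S))"
    by (simp add: inner_matrix_eq_trace matrix_transpose_mul tD matrix_mul_assoc)
  also have "\<dots> = trace (?D ** (T ** T))"
    by (subst trace_mul_sym) (simp add: T_def matrix_mul_assoc)
  also have "\<dots> = (\<Sum>i\<in>UNIV. \<Sum>j\<in>UNIV. d i * (T $ i $ j * T $ j $ i))"
    by (simp add: trace_def matrix_matrix_mult_def diagonal_matrix_def if_distrib if_distribR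
        sum_distrib_left cong: if_cong)
  also have "\<dots> = - (\<Sum>i\<in>UNIV. \<Sum>j\<in>UNIV. d i * (T $ i $ j)\<^sup>2)"
    by (simp add: skew_mult sum_negf)
  finally have *: "(P ** ?D ** transpose P) \<bullet> (S ** (P ** transpose P) ** S) = \<dots>" .
  have "(\<Sum>i\<in>UNIV. \<Sum>j\<in>UNIV. d j * (T $ i $ j)\<^sup>2) = (\<Sum>j\<in>UNIV. \<Sum>i\<in>UNIV. d j * (T $ i $ j)\<^sup>2)"
    by (rule sum.swap)
  also have "\<dots> = (\<Sum>i\<in>UNIV. \<Sum>j\<in>UNIV. d i * (T $ i $ j)\<^sup>2)"
    by (intro sum.cong refl) (simp only: skew_sq)
  finally show ?thesis
    unfolding * by (simp add: distrib_right sum.distrib)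
qed

text \<open>The diagonal of a skew-symmetric matrix vanishes, so only sums \<open>d i + d j\<close> with \<open>i \<noteq> j\<close> enter the
diagonalized form.\<close>

lemma quadratic_form_negative:
  fixes A S :: "real^'n^'n"
  assumes A: "transpose A = A" "almost_positive_definite A"
    and S: "transpose S = - S" "S \<noteq> 0"
  shows "A \<bullet> (S ** S) < 0"
proof -
  obtain P d where P: "orthogonal_matrix P" and Ad: "A = P ** diagonal_matrix d ** transpose P"
    using symmetric_matrix_diagonalization[OF A(1)] by blast
  have d: "0 < d i + d j" if "i \<noteq> j" for i j
    using A(2) that unfolding Ad almost_positive_definite_diagonalization[OF P] by blast
  have PP: "P ** transpose P = mat 1" using P by (simp add: orthogonal_matrix_def)
  define T where "T = transpose P ** S ** P"
  have "P ** T ** transpose P = (P ** transpose P) ** S ** (P ** transpose P)"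
    by (simp add: T_def matrix_mul_assoc)
  then have ST: "P ** T ** transpose P = S" by (simp add: PP)
  have "T \<noteq> 0"
  proof
    assume "T = 0"
    then have "P ** T ** transpose P = 0" by (simp add: matrix_matrix_mult_def vec_eq_iff)
    then show False using ST S(2) by simp
  qed
  then obtain i j where ij: "T $ i $ j \<noteq> 0" by (auto simp: vec_eq_iff)
  have "transpose T = transpose P ** (- S) ** P"
    by (simp add: T_def matrix_transpose_mul S matrix_mul_assoc)
  also have "\<dots> = - T"
    by (simp add: T_def matrix_matrix_mult_def vec_eq_iff sum_negf)
  finally have diag: "T $ i $ i = 0" for i
    using skew_matrix_component[of T i i] by linarith
  have nonneg: "0 \<le> (d i + d j) * (T $ i $ j)\<^sup>2" for i j
    using d[of i j] diag[of i] by (cases "i = j") auto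
  have "i \<noteq> j" using ij diag by auto
  then have "0 < (d i + d j) * (T $ i $ j)\<^sup>2"
    using d[of i j] ij by simp
  then have "0 < (\<Sum>j\<in>UNIV. (d i + d j) * (T $ i $ j)\<^sup>2)"
    by (intro sum_pos2[of _ j] nonneg) auto
  then have "0 < (\<Sum>i\<in>UNIV. \<Sum>j\<in>UNIV. (d i + d j) * (T $ i $ j)\<^sup>2)"
    using sum_pos2[of UNIV i "\<lambda>i. \<Sum>j\<in>UNIV. (d i + d j) * (T $ i $ j)\<^sup>2"]
    by (simp add: sum_nonneg nonneg)
  then show ?thesis
    using quadratic_form_diagonalization[OF S(1), of P d] by (simp add: Ad PP T_def)
qed

text \<open>Compactness of the unit sphere of the skew-symmetric matrices turns negativity into a uniform bound.
In dimension 1 this sphere is empty, and any constant will do.\<close>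

lemma quadratic_form_coercive:
  fixes A :: "real^'n^'n"
  assumes A: "transpose A = A" "almost_positive_definite A"
  obtains c where "0 < c" "\<And>S. transpose S = - S \<Longrightarrow> A \<bullet> (S ** S) \<le> - c * (norm S)\<^sup>2"
proof -
  define K where "K = {S :: real^'n^'n. transpose S = - S} \<inter> sphere 0 1"
  have scal: "transpose (t *\<^sub>R S) = - (t *\<^sub>R S)" if "transpose S = - S" for t and S :: "real^'n^'n"
    using that by (simp add: transpose_scalar)
  have scal2: "(t *\<^sub>R S) ** (t *\<^sub>R S) = t\<^sup>2 *\<^sub>R (S ** S)" for t and S :: "real^'n^'n"
    by (simp add: matrix_matrix_mult_def vec_eq_iff sum_distrib_left power2_eq_square mult_ac)
  have "closed {S :: real^'n^'n. transpose S = - S}"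
    unfolding transpose_def by (intro closed_Collect_eq continuous_intros)
  then have cpt: "compact K"
    unfolding K_def by (intro closed_Int_compact compact_sphere)
  have cont: "continuous_on K (\<lambda>S. A \<bullet> (S ** S))"
    unfolding matrix_matrix_mult_def by (intro continuous_intros)
  have "\<exists>c>0. \<forall>S\<in>K. A \<bullet> (S ** S) \<le> - c"
  proof (cases "K = {}")
    case True
    then show ?thesis by (intro exI[of _ 1]) auto
  next
    case False
    then obtain S where S: "S \<in> K" and max: "\<And>R. R \<in> K \<Longrightarrow> A \<bullet> (R ** R) \<le> A \<bullet> (S ** S)"
      using continuous_attains_sup[OF cpt _ cont] by blast
    have "A \<bullet> (S ** S) < 0"
      using S by (intro quadratic_form_negative A) (auto simp: K_def)
    then show ?thesis using max by (intro exI[of _ "- (A \<bullet> (S ** S))"]) auto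
  qed
  then obtain c where c: "c > 0" "\<And>S. S \<in> K \<Longrightarrow> A \<bullet> (S ** S) \<le> - c" by blast
  have "A \<bullet> (S ** S) \<le> - c * (norm S)\<^sup>2" if S: "transpose S = - S" for S
  proof (cases "S = 0")
    case False
    then have "(1 / norm S) *\<^sub>R S \<in> K"
      using scal[OF S] by (simp add: K_def)
    from c(2)[OF this] have "(1 / norm S)\<^sup>2 * (A \<bullet> (S ** S)) \<le> - c"
      by (simp only: scal2 inner_scaleR_right)
    then show ?thesis using False by (simp add: field_simps)
  qed (simp add: matrix_matrix_mult_def inner_vec_def)
  with c(1) that show ?thesis by blast
qed

section \<open>The local maximum\<close>

lemma strict_local_max_on_Psi_iff:
  fixes A :: "real^'n^'n"
  shows "strict_local_max_on (Psi A) {S. transpose S = - S} 0 \<longleftrightarrow>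
     (\<exists>e>0. \<forall>S. transpose S = - S \<and> S \<noteq> 0 \<and> norm S < e \<longrightarrow> Psi A S < 0)"
proof -
  have "transpose (0 :: real^'n^'n) = - 0" by (simp add: transpose_def vec_eq_iff)
  then show ?thesis
    unfolding strict_local_max_on_def eventually_at Psi_zero mem_Collect_eq dist_0_norm by auto
qed

lemma strict_local_max_if_almost_positive_definite:
  fixes A :: "real^'n^'n"
  assumes A: "transpose A = A" "almost_positive_definite A"
  shows "strict_local_max_on (Psi A) {S. transpose S = - S} 0"
proof -
  obtain c where c: "0 < c" "\<And>S. transpose S = - S \<Longrightarrow> A \<bullet> (S ** S) \<le> - c * (norm S)\<^sup>2"
    using quadratic_form_coercive[OF A] by blast
  define M where "M = norm A * exp 1"
  have M: "M \<ge> 0" by (simp add: M_def)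
  \<comment> \<open>Below this radius the cubic error \<open>M * norm S ^ 3\<close> stays under the quadratic decrease \<open>c * (norm S)\<^sup>2 / 2\<close>.\<close>
  define e where "e = min 1 (c / (2 * (M + 1)))"
  have "Psi A S < 0" if S: "transpose S = - S" "S \<noteq> 0" "norm S < e" for S
  proof -
    have "norm S < c / (2 * (M + 1))" using S(3) by (simp add: e_def)
    then have "norm S * (M + 1) < c / 2" using M by (simp add: field_simps)
    then have "norm S * M + norm S < c / 2" by (simp only: distrib_left mult_1_right)
    then have "M * norm S < c / 2" using norm_ge_zero[of S] by (simp only: mult.commute)
    then have "(norm S)\<^sup>2 * (M * norm S) < (norm S)\<^sup>2 * (c / 2)"
      using S(2) by (intro mult_strict_left_mono) auto
    then have "M * norm S ^ 3 < c * (norm S)\<^sup>2 / 2"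
      by (simp add: power2_eq_square power3_eq_cube mult_ac)
    moreover have "Psi A S \<le> A \<bullet> S + A \<bullet> (S ** S) / 2 + M * norm S ^ 3"
      using Psi_second_order[of S A] S(3) by (simp add: e_def M_def)
    ultimately show ?thesis
      using c(2)[OF S(1)] inner_symmetric_skew[OF A(1) S(1)] by simp
  qed
  moreover have "e > 0" using c(1) M by (simp add: e_def)
  ultimately show ?thesis unfolding strict_local_max_on_Psi_iff by blast
qed

text \<open>The differential of \<open>Psi A\<close> at 0 is \<open>S \<mapsto> A \<bullet> S\<close>. It is positive at the skew-symmetric matrix
\<open>A - transpose A\<close>, where it takes half the squared norm of that matrix as its value; so
\<open>Psi A\<close> takes positive values on this ray arbitrarily close to 0.\<close>

lemma symmetric_if_strict_local_max:
  fixes A :: "real^'n^'n"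
  assumes "strict_local_max_on (Psi A) {S. transpose S = - S} 0"
  shows "transpose A = A"
proof (rule ccontr)
  assume nsym: "transpose A \<noteq> A"
  obtain e where e: "e > 0" "\<And>S. \<lbrakk>transpose S = - S; S \<noteq> 0; norm S < e\<rbrakk> \<Longrightarrow> Psi A S < 0"
    using assms unfolding strict_local_max_on_Psi_iff by blast
  define S where "S = A - transpose A"
  have "S \<noteq> 0" using nsym by (simp add: S_def)
  have skew: "transpose (t *\<^sub>R S) = - (t *\<^sub>R S)" for t
    by (simp add: S_def transpose_def vec_eq_iff algebra_simps)
  have "S \<bullet> S = 2 * (A \<bullet> S)"
    using inner_transpose[of A A] inner_transpose[of A "transpose A"]
    by (simp add: S_def inner_diff_left inner_diff_right inner_commute)
  moreover have "S \<bullet> S > 0" using \<open>S \<noteq> 0\<close> by simp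
  ultimately have g: "A \<bullet> S > 0" by linarith
  \<comment> \<open>The remainder after the linear term is at most \<open>t\<^sup>2 * (C - 1)\<close> in absolute value on \<open>0 < t \<le> 1\<close>,
    so \<open>t * C \<le> A \<bullet> S\<close> leaves \<open>Psi A (t *\<^sub>R S)\<close> at least \<open>t\<^sup>2\<close>.\<close>
  define C where "C = \<bar>A \<bullet> (S ** S)\<bar> / 2 + norm A * exp 1 * norm S ^ 3 + 1"
  have C: "C > 0" by (simp add: C_def add_nonneg_pos)
  define t where "t = min (min 1 (1 / norm S)) (min (e / (2 * norm S)) (A \<bullet> S / C))"
  have nS: "norm S > 0" using \<open>S \<noteq> 0\<close> by simp
  have t0: "t > 0" using nS e(1) g C by (simp add: t_def)
  have t: "t \<le> 1" "t * norm S \<le> 1" "t * norm S < e" "t * C \<le> A \<bullet> S"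
  proof -
    show "t \<le> 1" by (simp add: t_def)
    have "t \<le> 1 / norm S" by (simp add: t_def)
    then show "t * norm S \<le> 1" using nS by (simp add: field_simps)
    have "t \<le> e / (2 * norm S)" by (simp add: t_def)
    then have "t * norm S \<le> e / 2" using nS by (simp add: field_simps)
    then show "t * norm S < e" using e(1) by linarith
    have "t \<le> A \<bullet> S / C" by (simp add: t_def)
    then show "t * C \<le> A \<bullet> S" using C by (simp add: field_simps)
  qed
  have nt: "norm (t *\<^sub>R S) = t * norm S" using t0 by simp
  have sq: "(t *\<^sub>R S) ** (t *\<^sub>R S) = t\<^sup>2 *\<^sub>R (S ** S)"
    by (simp add: matrix_matrix_mult_def vec_eq_iff sum_distrib_left power2_eq_square mult_ac)
  have "Psi A (t *\<^sub>R S) < 0"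
    using t0 \<open>S \<noteq> 0\<close> t(3) nt by (intro e(2) skew) auto
  moreover have "\<bar>Psi A (t *\<^sub>R S) - (t * (A \<bullet> S) + t\<^sup>2 * (A \<bullet> (S ** S)) / 2)\<bar>
      \<le> norm A * exp 1 * (t * norm S) ^ 3"
    using Psi_second_order[of "t *\<^sub>R S" A] t(2) nt by (simp only: sq inner_scaleR_right)
  moreover have "norm A * exp 1 * (t * norm S) ^ 3 \<le> t\<^sup>2 * (norm A * exp 1 * norm S ^ 3)"
  proof -
    have "t ^ 3 \<le> t\<^sup>2" using t0 t(1) by (intro power_decreasing) auto
    then have "t ^ 3 * (norm A * exp 1 * norm S ^ 3) \<le> t\<^sup>2 * (norm A * exp 1 * norm S ^ 3)"
      by (intro mult_right_mono) auto
    then show ?thesis by (simp add: power_mult_distrib mult_ac)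
  qed
  moreover have "t\<^sup>2 * (- (A \<bullet> (S ** S)) / 2) \<le> t\<^sup>2 * (\<bar>A \<bullet> (S ** S)\<bar> / 2)"
    by (intro mult_left_mono) auto
  moreover have "t * (t * C) \<le> t * (A \<bullet> S)"
    using t(4) t0 by (intro mult_left_mono) auto
  moreover have "t * (t * C)
      = t\<^sup>2 * (\<bar>A \<bullet> (S ** S)\<bar> / 2) + t\<^sup>2 * (norm A * exp 1 * norm S ^ 3) + t\<^sup>2"
    by (simp add: C_def power2_eq_square algebra_simps)
  moreover have "t\<^sup>2 * (- (A \<bullet> (S ** S)) / 2) = - (t\<^sup>2 * (A \<bullet> (S ** S)) / 2)"
    by simp
  ultimately have "t\<^sup>2 < 0"
    by linarith
  then show False by simp
qed

lemma outer_product_mult_vector: "outer_product x y *v z = (y \<bullet> z) *\<^sub>R x"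
  by (simp add: outer_product_def matrix_vector_mult_def vec_eq_iff inner_vec_def
      sum_distrib_left mult_ac)

lemma inner_outer_product:
  fixes A :: "real^'n^'n"
  shows "A \<bullet> outer_product x y = x \<bullet> (A *v y)"
  by (simp add: outer_product_def matrix_vector_mult_def inner_vec_def sum_distrib_left mult_ac)

text \<open>The exact value, not only the second-order term, is needed to exclude \<open>a + b = 0\<close>: then \<open>Psi A\<close>
vanishes on a whole line, so the maximum cannot be strict.\<close>

lemma Psi_rotation_of_eigenvectors:
  fixes A :: "real^'n^'n"
  assumes "norm x = 1" "norm y = 1" "x \<bullet> y = 0" "A *v x = a *\<^sub>R x" "A *v y = b *\<^sub>R y"
  defines "K \<equiv> outer_product x y - outer_product y x"
  shows "Psi A (t *\<^sub>R K) = (a + b) * (cos t - 1)"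
proof -
  have xy: "x \<bullet> x = 1" "y \<bullet> y = 1" "y \<bullet> x = 0"
    using assms(1-3) by (simp_all add: norm_eq_1 inner_commute)
  have Kv: "K *v z = (y \<bullet> z) *\<^sub>R x - (x \<bullet> z) *\<^sub>R y" for z
    by (simp add: K_def matrix_vector_mult_diff_rdistrib outer_product_mult_vector)
  have neg: "(- M) *v z = - (M *v z)" for M :: "real^'n^'n" and z
    by (simp add: matrix_vector_mult_def vec_eq_iff sum_negf)
  have K2: "K ** K = - (outer_product x x + outer_product y y)"
  proof -
    have "(K ** K) *v z = (- (outer_product x x + outer_product y y)) *v z" for z
    proof -
      have "(K ** K) *v z = - ((x \<bullet> z) *\<^sub>R x) - (y \<bullet> z) *\<^sub>R y"
        by (simp add: Kv xy assms(3) inner_diff_right flip: matrix_vector_mul_assoc)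
      also have "\<dots> = (- (outer_product x x + outer_product y y)) *v z"
        by (simp only: neg matrix_vector_mult_add_rdistrib outer_product_mult_vector minus_add_distrib
            diff_conv_add_uminus)
      finally show ?thesis .
    qed
    then show ?thesis by (simp add: matrix_eq)
  qed
  have K3: "K ** (K ** K) = - K"
  proof -
    have "(K ** (K ** K)) *v z = (- K) *v z" for z
    proof -
      have "(K ** (K ** K)) *v z = - (K *v z)"
        by (simp add: Kv xy assms(3) inner_diff_right flip: matrix_vector_mul_assoc)
      also have "\<dots> = (- K) *v z"
        by (simp only: neg)
      finally show ?thesis .
    qed
    then show ?thesis by (simp add: matrix_eq)
  qed
  have "A \<bullet> K = 0"
    by (simp add: K_def inner_diff_right inner_outer_product assms(3-5) xy)
  moreover have "A \<bullet> (K ** K) = - (a + b)"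
    by (simp add: K2 inner_diff_right inner_outer_product assms(4,5) xy)
  ultimately have "Psi A (t *\<^sub>R K) = - (a + b) * (1 - cos t)"
    using Psi_along_line_if_cube_eq_uminus[OF K3, of A t] by (simp only:)
  then show ?thesis by (simp add: algebra_simps)
qed

lemma almost_positive_definite_if_strict_local_max:
  fixes A :: "real^'n^'n"
  assumes max: "strict_local_max_on (Psi A) {S. transpose S = - S} 0"
    and sym: "transpose A = A"
  shows "almost_positive_definite A"
proof -
  obtain e where e: "e > 0" "\<And>S. \<lbrakk>transpose S = - S; S \<noteq> 0; norm S < e\<rbrakk> \<Longrightarrow> Psi A S < 0"
    using max unfolding strict_local_max_on_Psi_iff by blast
  obtain P d where P: "orthogonal_matrix P" and Ad: "A = P ** diagonal_matrix d ** transpose P"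
    using symmetric_matrix_diagonalization[OF sym] by blast
  have "A ** P = P ** diagonal_matrix d ** (transpose P ** P)"
    by (simp add: Ad matrix_mul_assoc)
  then have AP: "A ** P = P ** diagonal_matrix d"
    using P by (simp add: orthogonal_matrix_def)
  have eig: "A *v column i P = d i *\<^sub>R column i P" for i
  proof -
    have "A *v column i P = column i (A ** P)"
      by (simp add: matrix_vector_mult_def matrix_matrix_mult_def column_def)
    also have "\<dots> = d i *\<^sub>R column i P"
      unfolding AP by (simp add: vec_eq_iff matrix_matrix_mult_def diagonal_matrix_def column_def if_distrib
          mult.commute cong: if_cong)
    finally show ?thesis .
  qed
  have "0 < d i + d j" if "i \<noteq> j" for i j
  proof -
    define x y where "x = column i P" and "y = column j P"
    have xy: "norm x = 1" "norm y = 1" "x \<bullet> y = 0"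
      using P that by (auto simp: x_def y_def orthogonal_matrix_orthonormal_columns orthogonal_def)
    define K where "K = outer_product x y - outer_product y x"
    have "K *v y = x"
      using xy by (simp add: K_def matrix_vector_mult_diff_rdistrib outer_product_mult_vector norm_eq_1)
    then have "K \<noteq> 0" using xy by auto
    define t where "t = e / (2 * norm K)"
    have t: "t > 0" using \<open>K \<noteq> 0\<close> e(1) by (simp add: t_def)
    have "Psi A (t *\<^sub>R K) < 0"
    proof (rule e(2))
      show "transpose (t *\<^sub>R K) = - (t *\<^sub>R K)"
        by (simp add: K_def outer_product_def transpose_def vec_eq_iff algebra_simps)
      show "t *\<^sub>R K \<noteq> 0" using t \<open>K \<noteq> 0\<close> by simp
      show "norm (t *\<^sub>R K) < e" using t \<open>K \<noteq> 0\<close> e(1) by (simp add: t_def)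
    qed
    then have "(d i + d j) * (cos t - 1) < 0"
      using Psi_rotation_of_eigenvectors[OF xy eig[of i, folded x_def] eig[of j, folded y_def]]
      by (simp add: K_def)
    moreover have "cos t - 1 \<le> 0" by simp
    ultimately show ?thesis
      by (metis linorder_not_less mult_nonpos_nonpos)
  qed
  then show ?thesis
    unfolding Ad almost_positive_definite_diagonalization[OF P] by blast
qed

lemma strict_local_max_Psi_iff_almost_positive_definite:
  fixes A :: "real^'n^'n"
  shows "strict_local_max_on (Psi A) {S. transpose S = - S} 0 \<longleftrightarrow>
    transpose A = A \<and> almost_positive_definite A"
  using strict_local_max_if_almost_positive_definite symmetric_if_strict_local_max
    almost_positive_definite_if_strict_local_max by blast

theorem proposition15:
  fixes v :: "'n::finite option \<Rightarrow> real^'n"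
    and \<Delta> :: "(real^'n) set"
    and F :: "'n option \<Rightarrow> (real^'n) set"
    and k p :: "'n option \<Rightarrow> real^'n"
    and A :: "real^'n^'n"
  assumes "\<Delta> = convex hull (range v)"
    and "int CARD('n) simplex \<Delta>"
    and "positively_ordered v"
    and "\<And>i. F i = convex hull (v ` (UNIV - {i}))"
    and "\<And>i. outward_normal \<Delta> (F i) (k i)"
    and "\<And>i. norm (k i) = flat_volume (CARD('n) - 1) (F i)"
    and "\<And>i. p i \<in> rel_interior (F i)"
    and "A = (\<Sum>i\<in>UNIV. outer_product (k i) (p i))"
  shows "strict_local_max_on (Psi A) {S. transpose S = - S} 0 \<longleftrightarrow>
           transpose A = A \<and> almost_positive_definite A"
  by (rule strict_local_max_Psi_iff_almost_positive_definite)

end
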